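(* Let $p$ be an odd prime and $a\in\mathbb{Z}_p$ with $\langle a\rangle_p\equiv 1\pmod 2$. Then $$\sum_{k=0}^{p-1}\binom ak\binom{-1-a}k\binom{2k}k\frac 1{2^{2k}}\equiv 0\pmod{p^2}.$$
   Context: $\mathbb{Z}_p$ denotes the set of rational $p$-integers, i.e. rational numbers whose denominator is not divisible by $p$; congruences are in $\mathbb{Z}_p$. For $a\in\mathbb{Z}_p$, $\langle a\rangle_p\in\{0,1,\ldots,p-1\}$ is the least nonnegative residue of $a$ modulo $p$. $\binom ak=a(a-1)\cdots(a-k+1)/k!$ (with $\binom a0=1$). *)

theory Defs
  imports "HOL-Number_Theory.Number_Theory" "HOL.Rat"
begin

(* quotient_of yields the fraction in lowest terms with positive denominator. *)
definition p_integers :: "nat \<Rightarrow> rat set" where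
  "p_integers p = {x. \<not> int p dvd snd (quotient_of x)}"

(* Congruence in the ring of p-integers: both sides are p-integers and their
   difference lies in the ideal generated by m. *)
definition p_cong :: "nat \<Rightarrow> rat \<Rightarrow> rat \<Rightarrow> rat \<Rightarrow> bool" where
  "p_cong p x y m \<longleftrightarrow>
     x \<in> p_integers p \<and> y \<in> p_integers p \<and> (\<exists>z \<in> p_integers p. x - y = m * z)"

(* For prime p and a p-integer a the description is proper: see ex1_least_residue. *)
definition least_residue :: "nat \<Rightarrow> rat \<Rightarrow> nat" where
  "least_residue p a = (THE r. r < p \<and> p_cong p a (of_nat r) (of_nat p))"

lemma p_integers_iff:
  "x \<in> p_integers p \<longleftrightarrow> (\<exists>n d. \<not> int p dvd d \<and> x = of_int n / of_int d)"
proof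
  assume "x \<in> p_integers p"
  then show "\<exists>n d. \<not> int p dvd d \<and> x = of_int n / of_int d"
    unfolding p_integers_def
    by (metis (mono_tags, lifting) mem_Collect_eq prod.collapse quotient_of_div)
next
  assume "\<exists>n d. \<not> int p dvd d \<and> x = of_int n / of_int d"
  then obtain n d where nd: "\<not> int p dvd d" "x = of_int n / of_int d" by blast
  obtain u v where uv: "quotient_of x = (u, v)" by (cases "quotient_of x")
  have v: "v > 0" "coprime u v" "x = of_int u / of_int v"
    using quotient_of_denom_pos[OF uv] quotient_of_coprime[OF uv] quotient_of_div[OF uv] by auto
  have "d \<noteq> 0" using nd(1) by auto
  then have "(of_int (u * d) :: rat) = of_int (n * v)"
    using nd(2) v by (simp add: field_simps)
  then have "u * d = n * v" by (simp only: of_int_eq_iff)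
  then have "v dvd u * d" by simp
  then have "v dvd d" using v(2) by (simp add: coprime_commute coprime_dvd_mult_right_iff)
  then show "x \<in> p_integers p" using nd(1) uv by (auto simp: p_integers_def intro: dvd_trans)
qed

lemma ex1_least_residue:
  assumes p: "prime p" and a: "a \<in> p_integers p"
  shows "\<exists>!r. r < p \<and> p_cong p a (of_nat r) (of_nat p)"
proof -
  have p1: "p > 1" using p by (rule prime_gt_1_nat)
  have nat_int: "(of_nat r :: rat) \<in> p_integers p" for r
    unfolding p_integers_iff using p1 by (intro exI[of _ "int r"] exI[of _ 1]) auto
  obtain n d where nd: "\<not> int p dvd d" "a = of_int n / of_int d"
    using a p_integers_iff by blast
  have d0: "d \<noteq> 0" using nd(1) by auto
  have "coprime d (int p)"
    using nd(1) p by (metis coprime_commute prime_imp_coprime prime_nat_int_transfer)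
  then obtain e where e: "[d * e = 1] (mod int p)"
    using cong_solve_coprime_int by blast
  define r where "r = nat ((n * e) mod int p)"
  have r: "int r = (n * e) mod int p" "r < p"
    using p1 by (auto simp: r_def nat_less_iff)
  have "[d * int r = d * (n * e)] (mod int p)"
    unfolding r(1) by (simp add: cong_def mod_mult_right_eq)
  also have "[d * (n * e) = n] (mod int p)"
    using cong_scalar_left[OF e, of n] by (simp add: algebra_simps)
  finally have "int p dvd n - d * int r"
    by (simp add: cong_iff_dvd_diff dvd_diff_commute)
  then obtain t where t: "n - d * int r = int p * t" by auto
  have "a - of_nat r = of_int (n - d * int r) / of_int d"
    using nd(2) d0 by (simp add: field_simps)
  then have "a - of_nat r = of_nat p * (of_int t / of_int d)"
    unfolding t by simp
  moreover have "(of_int t / of_int d :: rat) \<in> p_integers p"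
    using nd(1) p_integers_iff by blast
  ultimately have ex: "p_cong p a (of_nat r) (of_nat p)"
    unfolding p_cong_def using a nat_int by blast
  have uniq: "s = r" if s: "s < p" "p_cong p a (of_nat s) (of_nat p)" for s
  proof -
    obtain z where z: "\<not> int p dvd snd (quotient_of z)" "a - of_nat s = of_nat p * z"
      using s unfolding p_cong_def p_integers_def by blast
    obtain w where w: "w \<in> p_integers p" "a - of_nat r = of_nat p * w"
      using ex unfolding p_cong_def by blast
    obtain u v where uv: "\<not> int p dvd v" "z = of_int u / of_int v"
      using z(1) p_integers_iff unfolding p_integers_def by blast
    obtain u' v' where uv': "\<not> int p dvd v'" "w = of_int u' / of_int v'"
      using w(1) p_integers_iff by blast
    have nz: "v \<noteq> 0" "v' \<noteq> 0" using uv(1) uv'(1) by auto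
    have "(of_nat r - of_nat s :: rat) = of_nat p * (z - w)"
      using z(2) w(2) by (simp add: algebra_simps)
    then have "(of_int ((int r - int s) * (v * v')) :: rat) = of_int (int p * (u * v' - u' * v))"
      using nz unfolding uv(2) uv'(2) by (simp add: field_simps)
    then have "(int r - int s) * (v * v') = int p * (u * v' - u' * v)"
      by (simp only: of_int_eq_iff)
    then have "int p dvd (int r - int s) * (v * v')" by simp
    then have "int p dvd int r - int s"
      using uv(1) uv'(1) p by (simp add: prime_dvd_mult_iff)
    then have "[int r = int s] (mod int p)" by (simp add: cong_iff_dvd_diff)
    then show "s = r" using s(1) r(2) by (simp add: cong_def)
  qed
  show ?thesis using ex r(2) uniq by blast
qed

end

theory Submission
  imports Defs "HOL-Computational_Algebra.Polynomial"
begin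

text \<open>
  Regard the sum as a polynomial $F(x)$ in $x = a$. Its $k$-th summand is
  $\binom{2k}{k} 4^{-k} (k!)^{-2} \prod_{j<k} (j(j+1) - x - x^2)$, and as $k < p$ and $p$ is odd,
  all coefficients of $F$ are $p$-integers. Write $n$ for the least residue of $a$. The heart of the
  proof is that $F$ has two exact rational roots congruent to $a$ modulo $p$, namely $n$ and
  $n - p$. Dividing by the monic factors $x - n$ and $x - (n - p)$ keeps the coefficients
  $p$-integral (\<open>poly_two_roots_p_integral\<close>), so $F(a) = (a - n)(a - n + p) g(a)$ with a
  $p$-integer $g(a)$, and each of the first two factors is divisible by $p$.

  That $F(n) = 0$ for odd $n < p$ is a terminating case of Whipple's summation of
  ${}_3F_2(-a, a+1, 1/2; 1, 1; 1)$; equivalently, the Legendre polynomial $P_n(\cos\theta)$ has mean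
  zero over the circle when $n$ is odd. Here it follows from a recurrence relating $F(a + 2)$
  and $F(a)$ obtained by creative telescoping (\<open>partial3F2_recurrence\<close>), starting from
  $F(1) = 0$. The root $n - p$ comes from the symmetry $F(-1-x) = F(x)$: it is the mirror image of
  $p - 1 - n$, which is again odd because $p$ is odd.
\<close>

section \<open>Vanishing at odd natural numbers\<close>

definition term3F2 :: "rat \<Rightarrow> nat \<Rightarrow> rat" where
  "term3F2 a k = (a gchoose k) * ((- 1 - a) gchoose k) * of_nat ((2 * k) choose k) * (1 / 2 ^ (2 * k))"

definition partial3F2 :: "nat \<Rightarrow> rat \<Rightarrow> rat" where
  "partial3F2 m a = (\<Sum>k<m. term3F2 a k)"

text \<open>
  Up to the factor $(a+1)(a+2)$, the summands at $a$ and at $a + 2$ are both polynomial multiples of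
  this hypergeometric term, which makes it the natural carrier of the telescoping certificate:
  no division by $a + 1 - k$ or $a + 2 - k$ occurs.
\<close>

definition mixed_term :: "rat \<Rightarrow> nat \<Rightarrow> rat" where
  "mixed_term a k =
     ((a + 2) gchoose k) * ((- 1 - a) gchoose k) * of_nat ((2 * k) choose k) * (1 / 2 ^ (2 * k))"

lemma partial3F2_reflect: "partial3F2 m (- 1 - a) = partial3F2 m a"
  by (simp add: partial3F2_def term3F2_def mult.commute)

lemma gbinomial_Suc_mult:
  "(of_nat k + 1) * (a gchoose Suc k) = (a - of_nat k) * (a gchoose k)"
  for a :: "'a :: field_char_0"
  using gbinomial_mult_1[of a k] by (simp add: algebra_simps)

lemma central_binomial_Suc:
  "(k + 1) * ((2 * Suc k) choose Suc k) = 2 * (2 * k + 1) * ((2 * k) choose k)"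
proof -
  have 1: "Suc k * (Suc (Suc (2*k)) choose Suc k) = Suc (Suc (2*k)) * (Suc (2*k) choose k)"
    by (rule Suc_times_binomial)
  have 2: "Suc k * (Suc (2*k) choose Suc k) = Suc (2*k) * ((2*k) choose k)"
    by (rule Suc_times_binomial)
  have "Suc (2*k) choose k = (Suc (2*k) choose Suc k)"
    using binomial_symmetric[of k "Suc (2*k)"] by (simp add: algebra_simps)
  then have "Suc k * (Suc k * ((2 * Suc k) choose Suc k))
      = Suc k * (2 * (2 * k + 1) * ((2 * k) choose k))"
    using 1 2 by (simp add: algebra_simps)
  then show ?thesis
    unfolding Suc_mult_cancel1 by (simp only: Suc_eq_plus1)
qed

lemma mixed_term_Suc:
  "2 * (of_nat k + 1) ^ 3 * mixed_term a (Suc k) =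
     (a + 2 - of_nat k) * (- 1 - a - of_nat k) * (2 * of_nat k + 1) * mixed_term a k"
proof -
  have c: "(of_nat k + 1) * (of_nat ((2 * Suc k) choose Suc k) :: rat)
      = 2 * (2 * of_nat k + 1) * of_nat ((2 * k) choose k)"
    using arg_cong[OF central_binomial_Suc[of k], of "of_nat :: nat \<Rightarrow> rat"]
    by (simp only: of_nat_mult of_nat_add of_nat_1 of_nat_numeral)
  have "2 * (of_nat k + 1) ^ 3 * mixed_term a (Suc k) =
     ((of_nat k + 1) * ((a + 2) gchoose Suc k)) * ((of_nat k + 1) * ((- 1 - a) gchoose Suc k))
     * ((of_nat k + 1) * of_nat ((2 * Suc k) choose Suc k)) * (2 / 2 ^ (2 * Suc k))"
    unfolding mixed_term_def power3_eq_cube by (simp only: mult_ac times_divide_eq_right mult_1_right)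
  also have "\<dots> = (a + 2 - of_nat k) * (- 1 - a - of_nat k) * (2 * of_nat k + 1) * mixed_term a k"
    unfolding gbinomial_Suc_mult c mixed_term_def by (simp add: field_simps)
  finally show ?thesis .
qed

lemma term3F2_eq_mixed_term:
  "(a + 1) * (a + 2) * term3F2 a k = (a + 2 - of_nat k) * (a + 1 - of_nat k) * mixed_term a k"
proof -
  have 1: "(a + 2 - of_nat k) * (a + 2 gchoose k) = (a + 2) * (a + 1 gchoose k)"
    using gbinomial_absorb_comp[of "a + 2" k] by (simp add: algebra_simps)
  have 2: "(a + 1 - of_nat k) * (a + 1 gchoose k) = (a + 1) * (a gchoose k)"
    using gbinomial_absorb_comp[of "a + 1" k] by (simp add: algebra_simps)
  have "(a + 1 - of_nat k) * ((a + 2 - of_nat k) * (a + 2 gchoose k))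
      = (a + 2) * ((a + 1) * (a gchoose k))"
    unfolding 1 2[symmetric] by (simp only: mult_ac)
  then show ?thesis
    unfolding term3F2_def mixed_term_def by (simp add: mult_ac)
qed

lemma term3F2_add_2_eq_mixed_term:
  "(a + 1) * (a + 2) * term3F2 (a + 2) k =
     (a + 1 + of_nat k) * (a + 2 + of_nat k) * mixed_term a k"
proof -
  have 1: "(- 1 - a - of_nat k) * (- 1 - a gchoose k) = (- 1 - a) * (- 2 - a gchoose k)"
  proof -
    have "- 1 - a - 1 = - 2 - a" by simp
    then show ?thesis using gbinomial_absorb_comp[of "- 1 - a" k] by simp
  qed
  have 2: "(- 2 - a - of_nat k) * (- 2 - a gchoose k) = (- 2 - a) * (- 3 - a gchoose k)"
  proof -
    have "- 2 - a - 1 = - 3 - a" by simp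
    then show ?thesis using gbinomial_absorb_comp[of "- 2 - a" k] by simp
  qed
  have 3: "- 1 - (a + 2) = - 3 - a" by simp
  have "(a + 1 + of_nat k) * (a + 2 + of_nat k) * (- 1 - a gchoose k)
      = (- 2 - a - of_nat k) * ((- 1 - a - of_nat k) * (- 1 - a gchoose k))"
    by (simp add: algebra_simps)
  also have "\<dots> = (- 1 - a) * ((- 2 - a - of_nat k) * (- 2 - a gchoose k))"
    unfolding 1 by (simp only: mult_ac)
  also have "\<dots> = (a + 1) * (a + 2) * (- 3 - a gchoose k)"
    unfolding 2 by (simp add: algebra_simps)
  finally show ?thesis
    unfolding term3F2_def mixed_term_def 3 by (simp add: mult_ac)
qed

text \<open>
  The right-hand side is the telescoping certificate: its increment from $m$ to $m + 1$ is a multiple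
  of \<open>mixed_term a m\<close> whose cofactor is a polynomial in $m$ and $a$, and it equals the increment
  of the left-hand side by a polynomial identity. For a natural number $a$ with $a + 2 < m$ the
  certificate vanishes, since $\binom{a+2}{m} = 0$.
\<close>

lemma partial3F2_recurrence:
  "(a + 1) * (a + 2) * ((a + 2)\<^sup>2 * partial3F2 m (a + 2) - (a + 1)\<^sup>2 * partial3F2 m a)
     = - 2 * (2 * a + 3) * of_nat m ^ 3 * mixed_term a m"
proof (induction m)
  case 0
  then show ?case by (simp add: partial3F2_def)
next
  case (Suc m)
  have split: "partial3F2 (Suc m) x = partial3F2 m x + term3F2 x m" for x
    by (simp add: partial3F2_def)
  let ?k = "of_nat m :: rat" and ?s = "mixed_term a m"
  have "(a + 1) * (a + 2) * ((a + 2)\<^sup>2 * partial3F2 (Suc m) (a + 2) - (a + 1)\<^sup>2 * partial3F2 (Suc m) a)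
      = (a + 1) * (a + 2) * ((a + 2)\<^sup>2 * partial3F2 m (a + 2) - (a + 1)\<^sup>2 * partial3F2 m a)
        + (a + 2)\<^sup>2 * ((a + 1) * (a + 2) * term3F2 (a + 2) m)
        - (a + 1)\<^sup>2 * ((a + 1) * (a + 2) * term3F2 a m)"
    unfolding split by (simp add: ring_distribs mult_ac)
  also have "\<dots> = (- 2 * (2 * a + 3) * ?k ^ 3
        + (a + 2)\<^sup>2 * ((a + 1 + ?k) * (a + 2 + ?k))
        - (a + 1)\<^sup>2 * ((a + 2 - ?k) * (a + 1 - ?k))) * ?s"
    unfolding Suc term3F2_eq_mixed_term term3F2_add_2_eq_mixed_term
    by (simp only: ring_distribs mult.assoc)
  also have "\<dots> = - (2 * a + 3) * ((a + 2 - ?k) * (- 1 - a - ?k) * (2 * ?k + 1)) * ?s"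
    by (rule arg_cong[where f = "\<lambda>x. x * ?s"])
      (simp add: power2_eq_square power3_eq_cube algebra_simps)
  also have "\<dots> = - (2 * a + 3) * (2 * (?k + 1) ^ 3 * mixed_term a (Suc m))"
    unfolding mixed_term_Suc by (simp only: mult.assoc)
  also have "\<dots> = - 2 * (2 * a + 3) * of_nat (Suc m) ^ 3 * mixed_term a (Suc m)"
    by (simp add: add.commute)
  finally show ?case .
qed

text \<open>
  For $a = n$ and $n + 2 < m$ the recurrence reads $(n+2)^2 F(n+2) = (n+1)^2 F(n)$, so the zero at
  $n = 1$, where the sum is $1 - 1$, propagates to all odd $n < m$.
\<close>

lemma partial3F2_odd_eq_0:
  assumes "odd n" "n < m"
  shows "partial3F2 m (of_nat n) = 0"
proof -
  have "partial3F2 m (of_nat (2 * i + 1)) = 0" if "2 * i + 1 < m" for i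
    using that
  proof (induction i)
    case 0
    have "partial3F2 m 1 = (\<Sum>k<2. term3F2 1 k)"
      unfolding partial3F2_def
    proof (rule sum.mono_neutral_right)
      have "(1 gchoose k :: rat) = 0" if "k \<ge> 2" for k
        using that binomial_gbinomial[of 1 k, where ?'a = rat] by (simp add: binomial_eq_0)
      then show "\<forall>k \<in> {..<m} - {..<2}. term3F2 1 k = 0"
        by (auto simp: term3F2_def)
    qed (use 0 in auto)
    also have "\<dots> = 0"
      by (simp add: term3F2_def numeral_2_eq_2)
    finally show ?case by simp
  next
    case (Suc i)
    define x :: rat where "x = of_nat (2 * i + 1)"
    have x: "x + 2 = of_nat (2 * Suc i + 1)" by (simp add: x_def)
    have "(x + 2 gchoose m) = 0"
      unfolding x binomial_gbinomial[symmetric] using Suc.prems by (simp add: binomial_eq_0)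
    then have "mixed_term x m = 0" by (simp add: mixed_term_def)
    moreover have "partial3F2 m x = 0" using Suc by (simp add: x_def)
    moreover have "x + 1 > 0" "x + 2 > 0" unfolding x_def by (auto intro: add_nonneg_pos)
    ultimately have "partial3F2 m (x + 2) = 0"
      using partial3F2_recurrence[of x m] by auto
    then show ?case unfolding x .
  qed
  moreover from \<open>odd n\<close> obtain i where "n = 2 * i + 1" by (elim oddE)
  ultimately show ?thesis using \<open>n < m\<close> by blast
qed

section \<open>Polynomials with p-integral coefficients\<close>

lemma p_integers_of_int [intro, simp]: "prime p \<Longrightarrow> of_int n \<in> p_integers p"
  unfolding p_integers_iff
  by (intro exI[of _ n] exI[of _ 1]) (auto dest: prime_gt_1_nat)

lemma p_integers_add:
  assumes "prime p" "x \<in> p_integers p" "y \<in> p_integers p"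
  shows "x + y \<in> p_integers p"
proof -
  obtain n d n' d' where *: "\<not> int p dvd d" "x = of_int n / of_int d"
      "\<not> int p dvd d'" "y = of_int n' / of_int d'"
    using assms p_integers_iff by blast
  then have "d \<noteq> 0" "d' \<noteq> 0" by auto
  then have "x + y = of_int (n * d' + n' * d) / of_int (d * d')"
    using * by (simp add: field_simps)
  moreover have "\<not> int p dvd d * d'"
    using * assms(1) by (simp add: prime_dvd_mult_iff)
  ultimately show ?thesis using p_integers_iff by blast
qed

lemma p_integers_mult:
  assumes "prime p" "x \<in> p_integers p" "y \<in> p_integers p"
  shows "x * y \<in> p_integers p"
proof -
  obtain n d n' d' where *: "\<not> int p dvd d" "x = of_int n / of_int d"
      "\<not> int p dvd d'" "y = of_int n' / of_int d'"
    using assms p_integers_iff by blast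
  then have "x * y = of_int (n * n') / of_int (d * d')" by simp
  moreover have "\<not> int p dvd d * d'"
    using * assms(1) by (simp add: prime_dvd_mult_iff)
  ultimately show ?thesis using p_integers_iff by blast
qed

lemma p_integers_sum:
  assumes "prime p" "\<And>i. i \<in> A \<Longrightarrow> f i \<in> p_integers p"
  shows "sum f A \<in> p_integers p"
  using assms(2) p_integers_of_int[OF assms(1), of 0]
  by (induction A rule: infinite_finite_induct) (auto intro: p_integers_add[OF assms(1)])

definition p_integral_polys :: "nat \<Rightarrow> rat poly set" where
  "p_integral_polys p = {f. \<forall>i. coeff f i \<in> p_integers p}"

lemma p_integral_polys_pCons_iff:
  "pCons c f \<in> p_integral_polys p \<longleftrightarrow> c \<in> p_integers p \<and> f \<in> p_integral_polys p"
  unfolding p_integral_polys_def by (auto simp: coeff_pCons split: nat.splits)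

lemma p_integral_polys_mult:
  "prime p \<Longrightarrow> f \<in> p_integral_polys p \<Longrightarrow> g \<in> p_integral_polys p \<Longrightarrow> f * g \<in> p_integral_polys p"
  unfolding p_integral_polys_def by (auto simp: coeff_mult intro!: p_integers_sum p_integers_mult)

lemma poly_in_p_integers:
  assumes "prime p" "f \<in> p_integral_polys p" "x \<in> p_integers p"
  shows "poly f x \<in> p_integers p"
  using assms(2)
proof (induction f)
  case 0
  then show ?case using p_integers_of_int[OF assms(1), of 0] by simp
next
  case (pCons c f)
  then show ?case
    using assms by (auto simp: p_integral_polys_pCons_iff intro!: p_integers_add p_integers_mult)
qed

text \<open>
  Division by a monic linear factor never divides coefficients: those of the quotient are Horner
  values of truncations of the polynomial.
\<close>

lemma synthetic_div_p_integral:
  assumes "prime p" "f \<in> p_integral_polys p" "c \<in> p_integers p"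
  shows "synthetic_div f c \<in> p_integral_polys p"
  using assms(2)
proof (induction f)
  case 0
  then show ?case by simp
next
  case (pCons b f)
  then show ?case
    using assms by (auto simp: p_integral_polys_pCons_iff poly_in_p_integers)
qed

text \<open>
  The roots of interest are congruent modulo $p$, so $y$ cannot be recognized as a root of the first
  quotient $h$ modulo $p$; but $(y - x) h(y) = 0$ holds exactly in the rationals, where $y - x$ cancels.
\<close>

lemma poly_two_roots_p_integral:
  assumes p: "prime p" and f: "f \<in> p_integral_polys p"
    and xy: "x \<in> p_integers p" "y \<in> p_integers p" "x \<noteq> y"
    and roots: "poly f x = 0" "poly f y = 0"
  obtains g where "g \<in> p_integral_polys p" "f = [:- x, 1:] * [:- y, 1:] * g"
proof -
  define h where "h = synthetic_div f x"
  have f_eq: "f = [:- x, 1:] * h"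
    using synthetic_div_correct'[of x f] roots(1) by (simp add: h_def)
  then have "poly h y = 0" using roots(2) xy(3) by simp
  then have "h = [:- y, 1:] * synthetic_div h y"
    using synthetic_div_correct'[of y h] by simp
  moreover have "synthetic_div h y \<in> p_integral_polys p"
    unfolding h_def by (intro synthetic_div_p_integral p f xy)
  ultimately show ?thesis using that f_eq by (metis mult.assoc)
qed

section \<open>The supercongruence\<close>

text \<open>
  The quadratic factor is $(x - j)(-1 - x - j)$, the product of the $j$-th factors of the two
  generalized binomial coefficients.
\<close>

definition term3F2_poly :: "nat \<Rightarrow> rat poly" where
  "term3F2_poly k = [:of_nat ((2 * k) choose k) / (4 ^ k * (fact k)\<^sup>2):]
     * (\<Prod>j<k. [:of_nat (j * (j + 1)), - 1, - 1:])"

lemma poly_term3F2_poly: "poly (term3F2_poly k) a = term3F2 a k"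
proof -
  have "(a gchoose k) * ((- 1 - a) gchoose k)
      = (\<Prod>j<k. (a - of_nat j) * (- 1 - a - of_nat j)) / (fact k)\<^sup>2"
    by (simp add: gbinomial_prod_rev prod.distrib power2_eq_square atLeast0LessThan)
  also have "(\<Prod>j<k. (a - of_nat j) * (- 1 - a - of_nat j))
      = (\<Prod>j<k. poly [:of_nat (j * (j + 1)), - 1, - 1:] a)"
    by (intro prod.cong) (auto simp: algebra_simps)
  finally have "term3F2 a k = (\<Prod>j<k. poly [:of_nat (j * (j + 1)), - 1, - 1:] a) / (fact k)\<^sup>2
      * of_nat ((2 * k) choose k) * (1 / 4 ^ k)"
    by (simp only: term3F2_def power_mult) simp
  then show ?thesis
    by (simp add: term3F2_poly_def poly_prod mult_ac)
qed

lemma term3F2_poly_p_integral: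
  assumes p: "prime p" "odd p" and "k < p"
  shows "term3F2_poly k \<in> p_integral_polys p"
proof -
  have int_p: "prime (int p)" using p by simp
  have int_const: "of_nat n \<in> p_integers p" "- 1 \<in> p_integers p" "0 \<in> p_integers p" for n
    using p_integers_of_int[OF p(1), of "int n"] p_integers_of_int[OF p(1), of "- 1"]
      p_integers_of_int[OF p(1), of 0] by simp_all
  have "\<not> int p dvd 2"
    using p by (metis int_dvd_int_iff of_nat_numeral primes_dvd_imp_eq two_is_prime_nat even_numeral)
  then have "\<not> int p dvd 4"
    using int_p prime_dvd_power[of "int p" 2 2] by auto
  moreover have "\<not> int p dvd fact k"
    using p(1) \<open>k < p\<close> by (metis of_nat_fact int_dvd_int_iff prime_dvd_fact_iff not_le)
  ultimately have "\<not> int p dvd 4 ^ k * (fact k)\<^sup>2"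
    by (metis int_p prime_dvd_mult_iff prime_dvd_power)
  moreover have "(of_nat ((2 * k) choose k) / (4 ^ k * (fact k)\<^sup>2) :: rat)
      = of_int (int ((2 * k) choose k)) / of_int (4 ^ k * (fact k)\<^sup>2)" by simp
  ultimately have lead: "(of_nat ((2 * k) choose k) / (4 ^ k * (fact k)\<^sup>2) :: rat) \<in> p_integers p"
    using p_integers_iff by blast
  have zero: "0 \<in> p_integral_polys p" by (simp add: p_integral_polys_def int_const)
  have "(\<Prod>j<i. [:of_nat (j * (j + 1)), - 1, - 1:]) \<in> p_integral_polys p" for i
  proof (induction i)
    case 0
    show ?case
      using int_const(1)[of 1] int_const(3) by (simp add: p_integral_polys_def coeff_1)
  next
    case (Suc i)
    then show ?case
      unfolding prod.lessThan_Suc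
      by (intro p_integral_polys_mult p Suc) (simp add: p_integral_polys_pCons_iff int_const zero del: of_nat_mult of_nat_add)
  qed
  then show ?thesis
    unfolding term3F2_poly_def
    by (intro p_integral_polys_mult p) (auto simp: p_integral_polys_pCons_iff zero lead)
qed

theorem theorem2p5:
  fixes p :: nat and a :: rat
  assumes "prime p" and "odd p"
    and "a \<in> p_integers p"
    and "[least_residue p a = 1] (mod 2)"
  shows "p_cong p
     (\<Sum>k = 0..p - 1. (a gchoose k) * ((- 1 - a) gchoose k) * of_nat ((2 * k) choose k)
        * (1 / 2 ^ (2 * k)))
     0 (of_nat p ^ 2)"
proof -
  note p = \<open>prime p\<close>
  have p_pos: "p > 0" using p by (rule prime_gt_0_nat)
  define n where "n = least_residue p a"
  have n: "n < p" "p_cong p a (of_nat n) (of_nat p)"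
    using theI'[OF ex1_least_residue[OF p assms(3)]] unfolding n_def least_residue_def by auto
  have "odd n" using assms(4) unfolding n_def cong_def by presburger
  obtain z where z: "z \<in> p_integers p" "a - of_nat n = of_nat p * z"
    using n(2) unfolding p_cong_def by blast
  define f where "f = (\<Sum>k<p. term3F2_poly k)"
  have poly_f: "poly f x = partial3F2 p x" for x
    by (simp add: f_def partial3F2_def poly_sum poly_term3F2_poly)
  have f_int: "f \<in> p_integral_polys p"
    using term3F2_poly_p_integral[OF p \<open>odd p\<close>] p
    by (auto simp: f_def p_integral_polys_def coeff_sum intro!: p_integers_sum)
  have root1: "poly f (of_nat n) = 0"
    unfolding poly_f by (rule partial3F2_odd_eq_0[OF \<open>odd n\<close> n(1)])
  (* The second root is the mirror image of p - 1 - n under x |-> -1 - x. *)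
  have "odd (p - 1 - n)" "p - 1 - n < p"
    using \<open>odd n\<close> \<open>odd p\<close> n(1) by auto
  then have "partial3F2 p (of_nat (p - 1 - n)) = 0" by (rule partial3F2_odd_eq_0)
  moreover have "- 1 - of_nat (p - 1 - n) = (of_nat n - of_nat p :: rat)"
    using n(1) by (simp add: of_nat_diff)
  ultimately have root2: "poly f (of_nat n - of_nat p) = 0"
    unfolding poly_f using partial3F2_reflect[of p "of_nat (p - 1 - n)"] by simp
  have ints: "of_nat n \<in> p_integers p" "of_nat n - of_nat p \<in> p_integers p" "1 \<in> p_integers p"
    using p_integers_of_int[OF p, of "int n"] p_integers_of_int[OF p, of "int n - int p"]
      p_integers_of_int[OF p, of 1] by simp_all
  have "(of_nat n :: rat) \<noteq> of_nat n - of_nat p" using p_pos by simp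
  then obtain g where g: "g \<in> p_integral_polys p"
      "f = [:- of_nat n, 1:] * [:- (of_nat n - of_nat p), 1:] * g"
    using poly_two_roots_p_integral[OF p f_int ints(1,2) _ root1 root2] by blast
  have "partial3F2 p a = (a - of_nat n) * (a - of_nat n + of_nat p) * poly g a"
    unfolding poly_f[symmetric] g(2) by (simp add: algebra_simps)
  also have "\<dots> = of_nat p ^ 2 * (z * (z + 1) * poly g a)"
    unfolding z(2) by (simp add: power2_eq_square algebra_simps)
  finally have eq: "partial3F2 p a = of_nat p ^ 2 * (z * (z + 1) * poly g a)" .
  have q: "z * (z + 1) * poly g a \<in> p_integers p"
    by (intro p_integers_mult p_integers_add poly_in_p_integers p z ints g assms)
  have "of_nat p ^ 2 \<in> p_integers p" "0 \<in> p_integers p"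
    using p_integers_of_int[OF p, of "int p ^ 2"] p_integers_of_int[OF p, of 0] by simp_all
  then have "p_cong p (partial3F2 p a) 0 (of_nat p ^ 2)"
    unfolding p_cong_def using eq q p_integers_mult[OF p _ q] by auto
  moreover have "{0..p - 1} = {..<p}" using p_pos by auto
  ultimately show ?thesis unfolding partial3F2_def term3F2_def by simp
qed

end
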